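(* Let $n,k,s$ be positive integers with $s\ge 2$ and $n>(s+\sqrt s)k$. Then $$ar(n,k,s)< e_k(n,s-1)+\frac{(s-1)n(n-sk)}{(n-sk)^2-k((2s-1)k-n)}+1.$$ In particular, for every fixed real $c>1$ and every $\delta>0$ there is $s_0$ such that for all integers $s\ge s_0$ and $k\ge1$ with $n=csk$ an integer, $ar(n,k,s)\le e_k(n,s-1)+(1+\delta)\,s\,\frac{c}{c-1}$.
   Context: An $M$-coloring of $\binom{[n]}{k}$ is a partition of $\binom{[n]}{k}$ into $M$ non-empty families (color classes). A rainbow $s$-matching is a set of $s$ pairwise disjoint $k$-sets from pairwise distinct color classes. $ar(n,k,s)$ is the minimum $M$ such that every $M$-coloring of $\binom{[n]}{k}$ contains a rainbow $s$-matching. For a family $\mathcal F$, $\nu(\mathcal F)$ is the maximum number of pairwise disjoint members, and for a positive integer $t$, $e_k(n,t)=\max\{|\mathcal F|:\mathcal F\subset\binom{[n]}{k},\ \nu(\mathcal F)<t\}$. *)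

theory Defs
  imports Complex_Main "HOL-Library.Disjoint_Sets" "HOL-Library.Ramsey"
begin

definition matching_number :: "nat set set \<Rightarrow> nat" where
  "matching_number F = Max {card G | G. G \<subseteq> F \<and> disjoint G}"

(* Used only for t >= 1, where the empty family qualifies and the maximum exists. *)
definition max_family_size :: "nat \<Rightarrow> nat \<Rightarrow> nat \<Rightarrow> nat" where
  "max_family_size k n t =
     Max {card F | F. F \<subseteq> nsets {1..n} k \<and> matching_number F < t}"

definition is_coloring :: "nat \<Rightarrow> nat \<Rightarrow> nat \<Rightarrow> nat set set set \<Rightarrow> bool" where
  "is_coloring n k M P \<longleftrightarrow> partition_on (nsets {1..n} k) P \<and> card P = M"

(* The injection \<phi> sends each set of the matching to its color class. *)
definition rainbow_matching :: "nat set set set \<Rightarrow> nat \<Rightarrow> nat set set \<Rightarrow> bool" where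
  "rainbow_matching P s R \<longleftrightarrow>
     finite R \<and> card R = s \<and> disjoint R \<and>
     (\<exists>\<phi>. inj_on \<phi> R \<and> (\<forall>A\<in>R. \<phi> A \<in> P \<and> A \<in> \<phi> A))"

(* The number of colors is required to be positive: for k <= n there is no coloring with
   0 colors, so M = 0 would satisfy the condition vacuously and the minimum would be 0.
   The minimum always exists, since there is no coloring with more than (n choose k) colors. *)
definition ar :: "nat \<Rightarrow> nat \<Rightarrow> nat \<Rightarrow> nat" where
  "ar n k s = (LEAST M. M \<ge> 1 \<and>
     (\<forall>P. is_coloring n k M P \<longrightarrow> (\<exists>R. rainbow_matching P s R)))"

end

theory Submission
  imports Defs "HOL-Analysis.Convex" "HOL-Real_Asymp.Real_Asymp"
begin

text \<open>
  Take a coloring without a rainbow \<open>s\<close>-matching and pick one representative of each color. As long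
  as more than \<open>e\<^sub>k(n, s - 1)\<close> colors are left, their representatives contain an
  \<open>(s - 1)\<close>-matching; record it and discard its colors. Every \<open>k\<close>-set in the complement of a
  recorded matching must have one of the colors of that matching, so two of these complements,
  which have \<open>u = n - (s - 1) k\<close> elements each, share fewer than \<open>k\<close> elements. By double counting
  and the Cauchy-Schwarz inequality there are then fewer than \<open>n (u - k) / (u\<^sup>2 - k n)\<close> recorded
  matchings.
\<close>

section \<open>Set systems with small pairwise intersections\<close>

text \<open>Both sides count the triples (i, j, x) with x in \<open>U i\<close> and in
  \<open>U j\<close>; the inner sum on the right is the degree of x.\<close>

lemma sum_card_Int_eq_sum_degree_square:
  fixes U :: "'i \<Rightarrow> 'a set"
  assumes "finite I" "finite X" "\<And>i. i \<in> I \<Longrightarrow> U i \<subseteq> X"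
  shows "(\<Sum>i\<in>I. \<Sum>j\<in>I. real (card (U i \<inter> U j))) = (\<Sum>x\<in>X. (\<Sum>i\<in>I. of_bool (x \<in> U i))\<^sup>2)"
proof -
  have "real (card (U i \<inter> U j)) = (\<Sum>x\<in>X. of_bool (x \<in> U i) * of_bool (x \<in> U j))"
    if "i \<in> I" "j \<in> I" for i j
  proof -
    have "U i \<inter> U j = X \<inter> {x. x \<in> U i \<and> x \<in> U j}"
      using assms(3) that by auto
    then have "real (card (U i \<inter> U j)) = (\<Sum>x\<in>X. of_bool (x \<in> U i \<and> x \<in> U j))"
      using assms(2) by (simp add: sum_of_bool_eq)
    then show ?thesis by (simp add: of_bool_conj)
  qed
  then have "(\<Sum>i\<in>I. \<Sum>j\<in>I. real (card (U i \<inter> U j))) =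
      (\<Sum>i\<in>I. \<Sum>j\<in>I. \<Sum>x\<in>X. of_bool (x \<in> U i) * of_bool (x \<in> U j))"
    by (intro sum.cong) auto
  also have "\<dots> = (\<Sum>i\<in>I. \<Sum>x\<in>X. \<Sum>j\<in>I. of_bool (x \<in> U i) * of_bool (x \<in> U j))"
    by (intro sum.cong refl sum.swap)
  also have "\<dots> = (\<Sum>x\<in>X. \<Sum>i\<in>I. \<Sum>j\<in>I. of_bool (x \<in> U i) * of_bool (x \<in> U j))"
    by (rule sum.swap)
  finally show ?thesis
    by (simp add: power2_eq_square sum_product)
qed

text \<open>Cauchy-Schwarz on the degrees: for m sets in an n-set the degrees add up to m u, so (m
  u)^2 is at most n times the sum of their squares, and double counting bounds that sum by m (u + (m
  - 1)(k - 1)). The multiplied-out form avoids a sign condition on u^2 - k n.\<close>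

lemma card_family_small_intersections:
  fixes U :: "'i \<Rightarrow> 'a set" and u k :: nat
  assumes I: "finite I" and X: "finite X"
    and sub: "\<And>i. i \<in> I \<Longrightarrow> U i \<subseteq> X"
    and card: "\<And>i. i \<in> I \<Longrightarrow> card (U i) = u"
    and int: "\<And>i j. i \<in> I \<Longrightarrow> j \<in> I \<Longrightarrow> i \<noteq> j \<Longrightarrow> card (U i \<inter> U j) < k"
    and less: "k < u" "u < card X"
  shows "real (card I) * ((real u)\<^sup>2 - real k * real (card X)) < real (card X) * (real u - real k)"
\<comment> \<open>The general argument is strict only because (m - 1) n > 0. For m = 0 strictness
  comes from k < u, for m = 1 from u < n.\<close>
proof (cases "card I \<le> 1")
  case True
  then consider "card I = 0" | "card I = 1" by linarith
  then show ?thesis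
  proof cases
    case 1
    then show ?thesis using less by auto
  next
    case 2
    have "real u * real u < real (card X) * real u"
      using less by (intro mult_strict_right_mono) auto
    then show ?thesis by (simp add: 2 power2_eq_square algebra_simps)
  qed
next
  case False
  define m n where "m = real (card I)" and "n = real (card X)"
  have m: "m \<ge> 2" and n: "n > 0" using False less by (auto simp: m_def n_def)
  have "(\<Sum>x\<in>X. \<Sum>i\<in>I. of_bool (x \<in> U i)) = (\<Sum>i\<in>I. \<Sum>x\<in>X. of_bool (x \<in> U i) :: real)"
    by (rule sum.swap)
  also have "\<dots> = (\<Sum>i\<in>I. real u)"
  proof (intro sum.cong refl)
    fix i assume "i \<in> I"
    then have "X \<inter> U i = U i" using sub by auto
    then show "(\<Sum>x\<in>X. of_bool (x \<in> U i)) = real u"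
      using X card \<open>i \<in> I\<close> by (simp add: sum_of_bool_eq)
  qed
  finally have deg: "(\<Sum>x\<in>X. \<Sum>i\<in>I. of_bool (x \<in> U i)) = m * real u"
    by (simp add: m_def)
  \<comment> \<open>The diagonal term is u; each of the other m - 1 terms is at most k - 1.\<close>
  have row: "(\<Sum>j\<in>I. real (card (U i \<inter> U j))) \<le> real u + (m - 1) * (real k - 1)" if "i \<in> I" for i
  proof -
    have "(\<Sum>j\<in>I. real (card (U i \<inter> U j))) = real u + (\<Sum>j\<in>I-{i}. real (card (U i \<inter> U j)))"
      using that card I by (simp add: sum.remove)
    also have "(\<Sum>j\<in>I-{i}. real (card (U i \<inter> U j))) \<le> (\<Sum>j\<in>I-{i}. real k - 1)"
    proof (rule sum_mono)
      fix j assume "j \<in> I - {i}"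
      then show "real (card (U i \<inter> U j)) \<le> real k - 1" using int[of i j] that by auto
    qed
    also have "\<dots> = (m - 1) * (real k - 1)"
      using that I m by (simp add: m_def of_nat_diff)
    finally show ?thesis by simp
  qed
  have "(m * real u)\<^sup>2 \<le> (\<Sum>x\<in>X. (\<Sum>i\<in>I. of_bool (x \<in> U i))\<^sup>2) * n"
    using sum_squared_le_sum_of_squares[where I = X and f = "\<lambda>x. \<Sum>i\<in>I. of_bool (x \<in> U i) :: real"]
    by (simp add: deg n_def)
  also have "\<dots> = (\<Sum>i\<in>I. \<Sum>j\<in>I. real (card (U i \<inter> U j))) * n"
    using sum_card_Int_eq_sum_degree_square[OF I X sub] by simp
  also have "\<dots> \<le> (\<Sum>i\<in>I. real u + (m - 1) * (real k - 1)) * n"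
    using n row by (intro mult_right_mono sum_mono) auto
  also have "\<dots> = m * ((real u + (m - 1) * (real k - 1)) * n)"
    by (simp add: m_def)
  finally have "m * (m * (real u)\<^sup>2) \<le> m * ((real u + (m - 1) * (real k - 1)) * n)"
    by (simp add: power2_eq_square mult_ac)
  then have "m * (real u)\<^sup>2 \<le> (real u + (m - 1) * (real k - 1)) * n"
    using m by simp
  \<comment> \<open>Since u + (m - 1)(k - 1) = (u - k) + m k - (m - 1), this is the slack that makes
    the final inequality strict.\<close>
  moreover have "0 < (m - 1) * n" using m n by simp
  ultimately have "m * ((real u)\<^sup>2 - real k * n) < n * (real u - real k)"
    by (simp add: algebra_simps)
  then show ?thesis by (simp add: m_def n_def)
qed

section \<open>Greedy extraction of matchings\<close>

text \<open>Each round removes exactly t elements, and rounds are possible until at most e elements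
  remain. In the application Q consists of colors and p demands disjoint representatives.\<close>

lemma greedy_disjoint_packing:
  assumes "finite Q" "t \<ge> 1"
    and "\<And>Q'. Q' \<subseteq> Q \<Longrightarrow> card Q' > e \<Longrightarrow> \<exists>W\<subseteq>Q'. card W = t \<and> p W"
  shows "\<exists>\<W>. disjoint \<W> \<and> \<Union>\<W> \<subseteq> Q \<and> (\<forall>W\<in>\<W>. card W = t \<and> p W) \<and> card Q \<le> e + t * card \<W>"
  using assms(1,3)
proof (induction Q rule: finite_psubset_induct)
  case (psubset Q)
  show ?case
  proof (cases "card Q \<le> e")
    case True
    then show ?thesis by (intro exI[of _ "{}"]) auto
  next
    case False
    then obtain W where W: "W \<subseteq> Q" "card W = t" "p W"
      using psubset.prems[of Q] by auto
    have fW: "finite W" "W \<noteq> {}" using W assms(2) psubset.hyps finite_subset by auto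
    then have "Q - W \<subset> Q" using W by auto
    then have "\<exists>\<W>. disjoint \<W> \<and> \<Union>\<W> \<subseteq> Q - W \<and> (\<forall>W\<in>\<W>. card W = t \<and> p W) \<and>
        card (Q - W) \<le> e + t * card \<W>"
    proof (rule psubset.IH)
      fix Q' assume "Q' \<subseteq> Q - W" "e < card Q'"
      then show "\<exists>W\<subseteq>Q'. card W = t \<and> p W" using psubset.prems[of Q'] by auto
    qed
    then obtain \<W> where \<W>: "disjoint \<W>" "\<Union>\<W> \<subseteq> Q - W" "\<forall>W\<in>\<W>. card W = t \<and> p W"
        "card (Q - W) \<le> e + t * card \<W>"
      by blast
    have "finite (\<Union>\<W>)" using \<W>(2) psubset.hyps by (meson finite_Diff finite_subset)
    then have fin: "finite \<W>" by (rule finite_UnionD)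
    \<comment> \<open>W is non-empty because t \<ge> 1, so it is a new member and the count really
      rises by one.\<close>
    have "W \<notin> \<W>" using \<W>(2) fW by auto
    moreover have "card Q = card (Q - W) + t"
      using W fW psubset.hyps by (metis card_Diff_subset card_mono le_add_diff_inverse2)
    ultimately have "card Q \<le> e + t * card (insert W \<W>)"
      using fin \<W>(4) by simp
    moreover have "disjoint (insert W \<W>)"
      using \<W>(1,2) by (auto simp: disjoint_def)
    ultimately show ?thesis
      using W \<W> by (intro exI[of _ "insert W \<W>"]) auto
  qed
qed

text \<open>By maximality of \<open>max_family_size k n t\<close>, the matching number of F is at
  least t; a maximum matching is then trimmed to size exactly t.\<close>

lemma obtain_matching:
  assumes "F \<subseteq> nsets {1..n} k" "t \<ge> 1" "card F > max_family_size k n t"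
  obtains G where "G \<subseteq> F" "disjoint G" "card G = t"
proof -
  have fin: "finite (nsets {1..n} k)" by (simp add: finite_imp_finite_nsets)
  have finF: "finite F" using assms(1) fin finite_subset by blast
  have "\<not> matching_number F < t"
  proof
    assume "matching_number F < t"
    then have "card F \<in> {card F | F. F \<subseteq> nsets {1..n} k \<and> matching_number F < t}"
      using assms(1) by auto
    moreover have "finite {card F | F. F \<subseteq> nsets {1..n} k \<and> matching_number F < t}"
      by (rule finite_subset[of _ "card ` Pow (nsets {1..n} k)"]) (use fin in auto)
    ultimately have "card F \<le> max_family_size k n t"
      unfolding max_family_size_def by simp
    then show False using assms(3) by simp
  qed
  moreover have "matching_number F \<in> {card G | G. G \<subseteq> F \<and> disjoint G}"
    unfolding matching_number_def
  proof (rule Max_in)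
    show "finite {card G | G. G \<subseteq> F \<and> disjoint G}"
      by (rule finite_subset[of _ "card ` Pow F"]) (use finF in auto)
    have "{} \<subseteq> F \<and> disjoint {}" by simp
    then show "{card G | G. G \<subseteq> F \<and> disjoint G} \<noteq> {}" by blast
  qed
  ultimately obtain G where G: "G \<subseteq> F" "disjoint G" "t \<le> card G" by auto
  then obtain H where "H \<subseteq> G" "card H = t"
    by (meson obtain_subset_with_card_n)
  then show ?thesis using that[of H] G pairwise_subset by blast
qed

section \<open>Colorings without a rainbow matching\<close>

lemma inj_on_representatives:
  assumes "disjoint P" "\<And>D. D \<in> P \<Longrightarrow> r D \<in> D"
  shows "inj_on r P"
proof (rule inj_onI)
  fix C D assume "C \<in> P" "D \<in> P" "r C = r D"
  then show "C = D"
    using disjointD[OF assms(1), of C D] assms(2)[of C] assms(2)[of D] by auto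
qed

text \<open>This yields the contradiction in the coloring argument: the representatives of W have
  distinct colors, and A contributes one more. Being non-empty and disjoint from them, A differs
  from all of them, so the size grows.\<close>

lemma rainbow_matching_insert:
  assumes P: "disjoint P" and W: "W \<subseteq> P" "finite W" "C \<in> P" "C \<notin> W" "A \<in> C" "A \<noteq> {}"
    and r: "\<And>D. D \<in> P \<Longrightarrow> r D \<in> D" and dis: "disjoint (r ` W)" and A: "A \<inter> \<Union>(r ` W) = {}"
  shows "rainbow_matching P (Suc (card W)) (insert A (r ` W))"
proof -
  have inj: "inj_on r P"
    using P r by (rule inj_on_representatives)
  then have injW: "inj_on r W" using W inj_on_subset by blast
  have "A \<notin> r ` W" using A W by blast
  \<comment> \<open>Color classes are disjoint, so the class is unique: \<open>\<phi>\<close>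
    inverts \<open>r\<close> on the representatives of W and maps A to C.\<close>
  define \<phi> where "\<phi> = (\<lambda>B. THE D. D \<in> P \<and> B \<in> D)"
  have \<phi>: "\<phi> B = D" if "D \<in> P" "B \<in> D" for B D
    unfolding \<phi>_def using P that by (intro the_equality) (auto simp: disjoint_def)
  have \<phi>r: "\<phi> (r D) = D" if "D \<in> W" for D using \<phi> r that W by blast
  have \<phi>A: "\<phi> A = C" using \<phi> W by blast
  have "inj_on \<phi> (insert A (r ` W))"
    using W \<phi>r \<phi>A by (auto simp: inj_on_def)
  moreover have "\<forall>B\<in>insert A (r ` W). \<phi> B \<in> P \<and> B \<in> \<phi> B"
    using W \<phi>r \<phi>A r by auto
  moreover have "disjoint (insert A (r ` W))"
    using dis A by (auto simp: disjoint_def)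
  ultimately show ?thesis
    unfolding rainbow_matching_def using W injW \<open>A \<notin> r ` W\<close>
    by (auto simp: card_image)
qed

text \<open>Here t = s - 1, and m is the number of recorded matchings. The greedy packing gives the
  first inequality; the small intersections of the complements, with u = n - t k, give the
  second.\<close>

lemma card_coloring_without_rainbow_matching:
  assumes col: "is_coloring n k M P" and none: "\<nexists>R. rainbow_matching P (Suc t) R"
    and k: "k \<ge> 1" and t: "t \<ge> 1" and n: "n > Suc t * k"
  obtains m where "M \<le> max_family_size k n t + t * m"
    "real m * ((real n - real t * real k)\<^sup>2 - real k * real n) < real n * (real n - real t * real k - real k)"
proof -
  have P: "\<Union>P = nsets {1..n} k" "disjoint P" "{} \<notin> P" "card P = M"
    using col by (auto simp: is_coloring_def partition_on_def)
  have finP: "finite P"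
    using P(1) by (metis finite_UnionD finite_atLeastAtMost finite_imp_finite_nsets)
  define r where "r = (\<lambda>D :: nat set set. SOME A. A \<in> D)"
  have r: "r D \<in> D" if "D \<in> P" for D
    using P(3) that by (auto simp: r_def some_in_eq)
  have rn: "r D \<in> nsets {1..n} k" if "D \<in> P" for D using P(1) r that by blast
  have inj: "inj_on r P"
    using P(2) r by (rule inj_on_representatives)
  \<comment> \<open>The packing runs over colors rather than k-sets, so distinct recorded matchings
    have no color in common.\<close>
  have "\<exists>\<W>. disjoint \<W> \<and> \<Union>\<W> \<subseteq> P \<and> (\<forall>W\<in>\<W>. card W = t \<and> disjoint (r ` W)) \<and>
      card P \<le> max_family_size k n t + t * card \<W>"
  proof (rule greedy_disjoint_packing[OF finP t])
    fix Q assume Q: "Q \<subseteq> P" "card Q > max_family_size k n t"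
    have injQ: "inj_on r Q" using inj Q inj_on_subset by blast
    then have "card (r ` Q) > max_family_size k n t" using Q by (simp add: card_image)
    moreover have "r ` Q \<subseteq> nsets {1..n} k" using rn Q by auto
    ultimately obtain G where G: "G \<subseteq> r ` Q" "disjoint G" "card G = t"
      using obtain_matching t by metis
    then obtain W where W: "W \<subseteq> Q" "G = r ` W" by (meson subset_imageE)
    then have "card W = t" using G injQ by (metis card_image inj_on_subset)
    then show "\<exists>W\<subseteq>Q. card W = t \<and> disjoint (r ` W)" using W G by blast
  qed
  then obtain \<W> where \<W>: "disjoint \<W>" "\<Union>\<W> \<subseteq> P" "\<And>W. W \<in> \<W> \<Longrightarrow> card W = t"
      "\<And>W. W \<in> \<W> \<Longrightarrow> disjoint (r ` W)" "M \<le> max_family_size k n t + t * card \<W>"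
    using P(4) by auto
  have fin: "finite \<W>" using \<W>(2) finP by (meson finite_UnionD finite_subset)
  have finW: "finite W" if "W \<in> \<W>" for W using \<W>(2) finP that by (meson Sup_le_iff finite_subset)
  define U where "U = (\<lambda>W. {1..n} - \<Union>(r ` W))"
  have cardU: "card (U W) = n - t * k" if "W \<in> \<W>" for W
  proof -
    have WP: "W \<subseteq> P" using that \<W>(2) by auto
    have "card (\<Union>(r ` W)) = (\<Sum>A\<in>r ` W. card A)"
      using rn WP by (intro card_Union_disjoint \<W>(4) that) (auto simp: nsets_def)
    also have "\<dots> = (\<Sum>A\<in>r ` W. k)"
      using rn WP by (intro sum.cong) (auto simp: nsets_def)
    also have "\<dots> = t * k"
      using \<W>(3)[OF that] inj WP by (simp add: card_image inj_on_subset)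
    finally have "card (\<Union>(r ` W)) = t * k" .
    moreover have "\<Union>(r ` W) \<subseteq> {1..n}" using rn WP by (fastforce simp: nsets_def)
    ultimately show ?thesis unfolding U_def
      by (simp add: card_Diff_subset finite_subset)
  qed
  \<comment> \<open>A color outside W would let A extend the recorded matching to a rainbow one of
    size t + 1.\<close>
  have color: "\<exists>C\<in>W. A \<in> C" if W: "W \<in> \<W>" and A: "A \<subseteq> U W" "card A = k" for W A
  proof (rule ccontr)
    assume no: "\<not> (\<exists>C\<in>W. A \<in> C)"
    \<comment> \<open>Infinite sets have \<open>card\<close> 0, which k \<ge> 1 excludes.\<close>
    have "finite A" using A k card.infinite by fastforce
    then have "A \<in> nsets {1..n} k" using A by (auto simp: nsets_def U_def)
    then obtain C where C: "C \<in> P" "A \<in> C" using P(1) by auto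
    have "rainbow_matching P (Suc (card W)) (insert A (r ` W))"
    proof (rule rainbow_matching_insert[OF P(2) _ finW[OF W] C(1) _ C(2) _ r \<W>(4)[OF W]])
      show "W \<subseteq> P" using W \<W>(2) by auto
      show "C \<notin> W" using no C by auto
      show "A \<noteq> {}" using A k by auto
      show "A \<inter> \<Union>(r ` W) = {}" using A by (auto simp: U_def)
    qed
    then show False using none \<W>(3)[OF W] by auto
  qed
  \<comment> \<open>A common k-subset would have its color both in V and in W, but it has only one
    color and V and W are disjoint.\<close>
  have int: "card (U V \<inter> U W) < k" if VW: "V \<in> \<W>" "W \<in> \<W>" "V \<noteq> W" for V W
  proof (rule ccontr)
    assume "\<not> card (U V \<inter> U W) < k"
    then obtain A where A: "A \<subseteq> U V \<inter> U W" "card A = k"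
      by (meson linorder_not_less obtain_subset_with_card_n)
    then obtain C D where CD: "C \<in> V" "D \<in> W" "A \<in> C" "A \<in> D"
      using color[OF VW(1), of A] color[OF VW(2), of A] by auto
    then have "C \<in> P" "D \<in> P" using \<W>(2) VW by auto
    then have "C = D" using P(2) CD by (auto simp: disjoint_def)
    then show False using CD \<W>(1) VW by (auto simp: disjoint_def)
  qed
  have "real (card \<W>) * ((real (n - t * k))\<^sup>2 - real k * real (card {1..n}))
      < real (card {1..n}) * (real (n - t * k) - real k)"
  proof (rule card_family_small_intersections[where U = U])
    show "U W \<subseteq> {1..n}" for W by (auto simp: U_def)
    \<comment> \<open>The first bound is n > (t + 1) k; the second holds because t k > 0.\<close>
    show "k < n - t * k" "n - t * k < card {1..n}" using n k t by auto
  qed (use fin cardU int in auto)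
  moreover have "real (n - t * k) = real n - real t * real k" using n by (simp add: of_nat_diff)
  ultimately show ?thesis using that[of "card \<W>"] \<W>(5) by simp
qed

section \<open>From colorings to the bound on \<open>ar\<close>\<close>

text \<open>No coloring with ceiling-of-x many colors avoids a rainbow matching, so this number is a
  candidate in the \<open>LEAST\<close> defining \<open>ar\<close>; x > 0 makes it at least 1.
  Rounding up costs less than 1, which is the source of the final + 1.\<close>

lemma real_ar_less:
  assumes "0 < x" "\<And>M P. is_coloring n k M P \<Longrightarrow> \<nexists>R. rainbow_matching P s R \<Longrightarrow> real M < x"
  shows "real (ar n k s) < x + 1"
proof -
  define M where "M = nat \<lceil>x\<rceil>"
  have M: "M \<ge> 1" "x \<le> real M" "real M < x + 1"
    using assms(1) unfolding M_def by linarith+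
  have "ar n k s \<le> M"
    unfolding ar_def using M assms(2)[of M] by (intro Least_le) fastforce
  then show ?thesis using M by linarith
qed

text \<open>With u = n - (s - 1) k one has u - k = n - s k, and u^2 - k n is the denominator of the
  bound. The lower bound on n makes it positive, so the inequality for m can be divided by
  it.\<close>

lemma ar_bound:
  fixes n k s :: nat
  assumes k: "k \<ge> 1" and s: "s \<ge> 2" and n: "real n > (real s + sqrt (real s)) * real k"
  shows "real (ar n k s) < real (max_family_size k n (s - 1))
        + (real s - 1) * real n * (real n - real s * real k)
            / ((real n - real s * real k)^2 - real k * ((2 * real s - 1) * real k - real n))
        + 1"
proof -
  define d where "d = real n - real s * real k"
  define D where "D = d\<^sup>2 - real k * ((2 * real s - 1) * real k - real n)"
  have sqrt: "sqrt (real s) * real k < d" using n by (simp add: d_def algebra_simps)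
  then have "(sqrt (real s) * real k)\<^sup>2 < d\<^sup>2"
    by (intro power_strict_mono) auto
  then have sq: "real s * (real k)\<^sup>2 < d\<^sup>2" by (simp add: power_mult_distrib)
  have d: "d > 0" using sqrt by (meson le_less_trans mult_nonneg_nonneg of_nat_0_le_iff real_sqrt_ge_zero)
  \<comment> \<open>Regrouped so that positivity is visible from d > 0 and d^2 > s k^2, the squared
    form of the hypothesis on n.\<close>
  have "D = (d\<^sup>2 - real s * (real k)\<^sup>2) + real k * d + (real k)\<^sup>2"
    by (simp add: D_def d_def power2_eq_square algebra_simps)
  then have D: "D > 0" using sq d by (smt (verit) mult_nonneg_nonneg of_nat_0_le_iff zero_le_power2)
  have Suc: "Suc (s - 1) = s" "s - 1 \<ge> 1" using s by auto
  have n0: "real n > 0" using d unfolding d_def by (smt (verit) mult_nonneg_nonneg of_nat_0_le_iff)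
  have sk: "n > Suc (s - 1) * k"
  proof -
    have "real (s * k) < real n" using d by (simp add: d_def)
    then show ?thesis using s by (simp only: of_nat_less_iff) simp
  qed
  have "real (ar n k s) < (real (max_family_size k n (s - 1)) + (real s - 1) * real n * d / D) + 1"
  proof (rule real_ar_less)
    have "(real s - 1) * real n * d / D > 0" using s n0 d D by simp
    then show "0 < real (max_family_size k n (s - 1)) + (real s - 1) * real n * d / D" by linarith
  next
    fix M P assume "is_coloring n k M P" "\<nexists>R. rainbow_matching P s R"
    then obtain m where m: "M \<le> max_family_size k n (s - 1) + (s - 1) * m"
      "real m * ((real n - real (s - 1) * real k)\<^sup>2 - real k * real n)
        < real n * (real n - real (s - 1) * real k - real k)"
      using card_coloring_without_rainbow_matching[of n k M P "s - 1"] k sk Suc by metis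
    have s1: "real (s - 1) = real s - 1" using s by (simp add: of_nat_diff)
    have "(real n - real (s - 1) * real k)\<^sup>2 - real k * real n = D"
      unfolding s1 by (simp add: D_def d_def power2_eq_square algebra_simps)
    moreover have "real n - real (s - 1) * real k - real k = d"
      unfolding s1 by (simp add: d_def algebra_simps)
    ultimately have "real m < real n * d / D"
      using m(2) D by (simp add: pos_less_divide_eq)
    then have "(real s - 1) * real m < (real s - 1) * (real n * d / D)"
      using s by (intro mult_strict_left_mono) auto
    moreover have "real M \<le> real (max_family_size k n (s - 1)) + (real s - 1) * real m"
      using m(1) by (metis of_nat_add of_nat_le_iff of_nat_mult s1)
    ultimately show "real M < real (max_family_size k n (s - 1)) + (real s - 1) * real n * d / D"
      by simp
  qed
  then show ?thesis by (simp add: D_def d_def)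
qed

section \<open>Asymptotics for n = c s k\<close>

text \<open>This is the case n = c s k of the bound after cancelling k^2, together with the
  conditions for applying \<open>ar_bound\<close>. The left side of the last inequality divided by s
  c / (c - 1) tends to 1, hence is eventually below 1 + \<open>\<delta>\<close>.\<close>

lemma eventually_bound_linear:
  fixes c \<delta> :: real
  assumes "c > 1" "\<delta> > 0"
  shows "eventually (\<lambda>s::nat. s \<ge> 2 \<and> real s + sqrt (real s) < c * real s \<and>
    (real s - 1) * (c * real s) * (c * real s - real s)
       / ((c * real s - real s)\<^sup>2 - (2 * real s - 1 - c * real s)) + 1
      \<le> (1 + \<delta>) * real s * (c / (c - 1))) sequentially"
proof -
  define d where "d = c - 1"
  have d: "d > 0" "c = 1 + d" using assms by (auto simp: d_def)
  have e1: "eventually (\<lambda>s::nat. real s + sqrt (real s) < (1 + d) * real s) sequentially"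
    using d by real_asymp
  \<comment> \<open>This is d^2 (1 + d), the leading coefficient of the denominator once the nested
    fractions are cleared.\<close>
  have nz: "d * d + d * (d * d) \<noteq> 0"
    using d by (smt (verit) mult_pos_pos)
  have "((\<lambda>s::nat. ((real s - 1) * ((1 + d) * real s) * (d * real s)
       / ((d * real s)\<^sup>2 - ((1 - d) * real s - 1)) + 1) / (real s * ((1 + d) / d))) \<longlongrightarrow> 1) sequentially"
    using d nz by (real_asymp simp: field_simps power2_eq_square)
  then have e2: "eventually (\<lambda>s::nat. ((real s - 1) * ((1 + d) * real s) * (d * real s)
       / ((d * real s)\<^sup>2 - ((1 - d) * real s - 1)) + 1) / (real s * ((1 + d) / d)) < 1 + \<delta>) sequentially"
    using assms(2) by (intro order_tendstoD) auto
  show ?thesis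
    using e1 e2 eventually_ge_at_top[of 2]
  proof eventually_elim
    case (elim s)
    have "real s * ((1 + d) / d) > 0" using elim d by simp
    then have "(real s - 1) * ((1 + d) * real s) * (d * real s)
       / ((d * real s)\<^sup>2 - ((1 - d) * real s - 1)) + 1 < (1 + \<delta>) * (real s * ((1 + d) / d))"
      using elim(2) by (simp only: pos_divide_less_eq)
    moreover have "c * real s - real s = d * real s" "2 * real s - 1 - c * real s = (1 - d) * real s - 1"
      by (simp_all add: d(2) algebra_simps)
    moreover have "(1 + \<delta>) * real s * (c / (c - 1)) = (1 + \<delta>) * (real s * ((1 + d) / d))"
      by (simp add: d(2))
    ultimately show ?case
      using elim by (simp only: d(2)) simp
  qed
qed

theorem theorem6:
  "(\<forall>n k s :: nat. n \<ge> 1 \<longrightarrow> k \<ge> 1 \<longrightarrow> s \<ge> 2 \<longrightarrow> real n > (real s + sqrt (real s)) * real k \<longrightarrow>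
      real (ar n k s) <
        real (max_family_size k n (s - 1))
        + (real s - 1) * real n * (real n - real s * real k)
            / ((real n - real s * real k)^2 - real k * ((2 * real s - 1) * real k - real n))
        + 1)
   \<and>
   (\<forall>c \<delta> :: real. c > 1 \<longrightarrow> \<delta> > 0 \<longrightarrow>
      (\<exists>s0 :: nat. \<forall>s k n :: nat. s \<ge> s0 \<longrightarrow> k \<ge> 1 \<longrightarrow> real n = c * real s * real k \<longrightarrow>
         real (ar n k s) \<le>
           real (max_family_size k n (s - 1)) + (1 + \<delta>) * real s * (c / (c - 1))))"
proof (intro conjI allI impI)
  fix n k s :: nat
  assume "k \<ge> 1" "s \<ge> 2" "real n > (real s + sqrt (real s)) * real k"
  then show "real (ar n k s) < real (max_family_size k n (s - 1))
        + (real s - 1) * real n * (real n - real s * real k)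
            / ((real n - real s * real k)^2 - real k * ((2 * real s - 1) * real k - real n))
        + 1"
    by (rule ar_bound)
next
  fix c \<delta> :: real
  assume "c > 1" "\<delta> > 0"
  \<comment> \<open>k has already cancelled here, so \<open>s0\<close> depends on c and
    \<open>\<delta>\<close> only.\<close>
  then obtain s0 :: nat where s0: "\<And>s. s \<ge> s0 \<Longrightarrow> s \<ge> 2 \<and> real s + sqrt (real s) < c * real s \<and>
    (real s - 1) * (c * real s) * (c * real s - real s)
       / ((c * real s - real s)\<^sup>2 - (2 * real s - 1 - c * real s)) + 1
      \<le> (1 + \<delta>) * real s * (c / (c - 1))"
    using eventually_bound_linear[of c \<delta>] unfolding eventually_sequentially by blast
  show "\<exists>s0 :: nat. \<forall>s k n :: nat. s \<ge> s0 \<longrightarrow> k \<ge> 1 \<longrightarrow> real n = c * real s * real k \<longrightarrow>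
         real (ar n k s) \<le>
           real (max_family_size k n (s - 1)) + (1 + \<delta>) * real s * (c / (c - 1))"
  proof (intro exI[of _ s0] allI impI)
    fix s k n :: nat
    assume s: "s \<ge> s0" and k: "k \<ge> 1" and n: "real n = c * real s * real k"
    define a b where "a = real s" and "b = real k"
    have b: "b > 0" using k by (simp add: b_def)
    have "real n > (real s + sqrt (real s)) * real k"
      unfolding n using s0[OF s] k by (intro mult_strict_right_mono) auto
    from ar_bound[OF k _ this] s0[OF s]
    have "real (ar n k s) < real (max_family_size k n (s - 1))
        + (a - 1) * (c * a * b) * (c * a * b - a * b)
            / ((c * a * b - a * b)^2 - b * ((2 * a - 1) * b - c * a * b)) + 1"
      by (simp add: n a_def b_def)
    \<comment> \<open>Numerator and denominator are both homogeneous of degree 2 in b = k, so k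
      drops out.\<close>
    also have "(a - 1) * (c * a * b) * (c * a * b - a * b)
            / ((c * a * b - a * b)^2 - b * ((2 * a - 1) * b - c * a * b))
         = (b\<^sup>2 * ((a - 1) * (c * a) * (c * a - a))) / (b\<^sup>2 * ((c * a - a)^2 - (2 * a - 1 - c * a)))"
      by (intro arg_cong2[of _ _ _ _ "(/)"]) (simp_all add: power2_eq_square algebra_simps)
    also have "\<dots> = (a - 1) * (c * a) * (c * a - a) / ((c * a - a)^2 - (2 * a - 1 - c * a))"
      using b by simp
    finally show "real (ar n k s) \<le>
           real (max_family_size k n (s - 1)) + (1 + \<delta>) * real s * (c / (c - 1))"
      using s0[OF s] by (simp add: a_def)
  qed
qed

end
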